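(* Let $\mathcal{L}$ be a first-order language, let $\mathcal{A}$ be a finite $\mathcal{L}$-structure, and let $I$ be any index set. Then the direct power $\Pi\mathcal{A}=\prod_{i\in I}\mathcal{A}$ is weakly $\mathcal{L}(\Pi\mathcal{A})$-equationally Noetherian.
   Context: The direct power $\Pi\mathcal{A}=\prod_{i\in I}\mathcal{A}$ of an $\mathcal{L}$-structure $\mathcal{A}$ consists of all families $[a_i\mid i\in I]$ with $a_i\in\mathcal{A}$; functions and relations are defined coordinate-wise (a relation holds in $\Pi\mathcal{A}$ iff it holds in every coordinate $i\in I$). For an $\mathcal{L}$-structure $\mathcal{B}$, $\mathcal{L}(\mathcal{B})$ is the language $\mathcal{L}\cup\{b\mid b\in\mathcal{B}\}$ obtained by adding a constant symbol for every element of $\mathcal{B}$, interpreted by that element. An $\mathcal{L}(\mathcal{B})$-equation is an atomic formula of $\mathcal{L}(\mathcal{B})$ (equalities included). An $\mathcal{L}(\mathcal{B})$-system is an arbitrary set of $\mathcal{L}(\mathcal{B})$-equations in a finite set of variables $x_1,\dots,x_n$; its solution set over $\mathcal{B}$ is the set of points of $\mathcal{B}^n$ satisfying all its equations. Two systems in the same variables are equivalent over $\mathcal{B}$ if they have the same solution set. $\mathcal{B}$ is weakly $\mathcal{L}(\mathcal{B})$-equationally Noetherian if every infinite $\mathcal{L}(\mathcal{B})$-system $\mathbf{S}$ is equivalent over $\mathcal{B}$ to some finite $\mathcal{L}(\mathcal{B})$-system $\mathbf{S}'$ (in the same variables; $\mathbf{S}'$ is not required to be a subset of $\mathbf{S}$).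 *)

theory Defs
  imports "HOL-Library.FuncSet"
begin

section \<open>First-order languages and structures\<close>

text \<open>The symbols form sets rather than whole types, so that a language may lack function
  symbols or relation symbols. Constant symbols are function symbols of arity 0.\<close>

record ('f, 'r) fo_language =
  fun_syms :: "'f set"
  rel_syms :: "'r set"
  fun_arity :: "'f \<Rightarrow> nat"
  rel_arity :: "'r \<Rightarrow> nat"

record ('f, 'r, 'a) fo_structure =
  universe :: "'a set"
  fun_interp :: "'f \<Rightarrow> 'a list \<Rightarrow> 'a"
  rel_interp :: "'r \<Rightarrow> 'a list \<Rightarrow> bool"

definition points :: "nat \<Rightarrow> 'a set \<Rightarrow> 'a list set" where
  "points n X = {xs. length xs = n \<and> set xs \<subseteq> X}"

text \<open>Interpretations are total HOL functions; only their values at symbols of the language and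
  at tuples of the right length over the universe are meaningful. As usual in first-order
  logic, structures are nonempty.\<close>

definition is_structure :: "('f, 'r) fo_language \<Rightarrow> ('f, 'r, 'a) fo_structure \<Rightarrow> bool" where
  "is_structure L A \<longleftrightarrow>
     universe A \<noteq> {} \<and>
     (\<forall>f \<in> fun_syms L. \<forall>xs \<in> points (fun_arity L f) (universe A).
        fun_interp A f xs \<in> universe A)"


section \<open>Terms, equations, systems\<close>

datatype 'f fo_term = Var nat | App 'f "'f fo_term list"

datatype ('f, 'r) atomic_formula =
    Equality "'f fo_term" "'f fo_term"
  | Relation 'r "'f fo_term list"

text \<open>The variables $x_1, \ldots, x_n$ are represented as \<open>Var 0, \<dots>, Var (n - 1)\<close>.\<close>

inductive_set terms_over :: "('f, 'r) fo_language \<Rightarrow> nat \<Rightarrow> 'f fo_term set"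
  for L :: "('f, 'r) fo_language" and n :: nat where
  Var: "i < n \<Longrightarrow> Var i \<in> terms_over L n"
| App: "f \<in> fun_syms L \<Longrightarrow> length ts = fun_arity L f \<Longrightarrow> (\<And>t. t \<in> set ts \<Longrightarrow> t \<in> terms_over L n)
    \<Longrightarrow> App f ts \<in> terms_over L n"

definition equations_over :: "('f, 'r) fo_language \<Rightarrow> nat \<Rightarrow> ('f, 'r) atomic_formula set" where
  "equations_over L n =
     {Equality s t | s t. s \<in> terms_over L n \<and> t \<in> terms_over L n} \<union>
     {Relation r ts | r ts. r \<in> rel_syms L \<and> ts \<in> points (rel_arity L r) (terms_over L n)}"

primrec term_value :: "('f, 'r, 'a) fo_structure \<Rightarrow> 'a list \<Rightarrow> 'f fo_term \<Rightarrow> 'a" where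
  "term_value A p (Var i) = p ! i"
| "term_value A p (App f ts) = fun_interp A f (map (term_value A p) ts)"

primrec satisfies :: "('f, 'r, 'a) fo_structure \<Rightarrow> 'a list \<Rightarrow> ('f, 'r) atomic_formula \<Rightarrow> bool" where
  "satisfies A p (Equality s t) \<longleftrightarrow> term_value A p s = term_value A p t"
| "satisfies A p (Relation r ts) \<longleftrightarrow> rel_interp A r (map (term_value A p) ts)"

definition solution_set ::
    "('f, 'r, 'a) fo_structure \<Rightarrow> nat \<Rightarrow> ('f, 'r) atomic_formula set \<Rightarrow> 'a list set" where
  "solution_set A n S = {p \<in> points n (universe A). \<forall>e \<in> S. satisfies A p e}"

definition equivalent_systems ::
    "('f, 'r, 'a) fo_structure \<Rightarrow> nat \<Rightarrow> ('f, 'r) atomic_formula set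
      \<Rightarrow> ('f, 'r) atomic_formula set \<Rightarrow> bool" where
  "equivalent_systems A n S S' \<longleftrightarrow> solution_set A n S = solution_set A n S'"


section \<open>Adding constants: the language $\mathcal{L}(\mathcal{B})$\<close>

text \<open>\<open>Inl f\<close> is the original symbol \<open>f\<close>, and \<open>Inr b\<close> is the constant symbol naming \<open>b\<close>.\<close>

definition language_with_constants ::
    "('f, 'r) fo_language \<Rightarrow> ('f, 'r, 'b) fo_structure \<Rightarrow> ('f + 'b, 'r) fo_language" where
  "language_with_constants L B =
     \<lparr>fun_syms = fun_syms L <+> universe B,
      rel_syms = rel_syms L,
      fun_arity = case_sum (fun_arity L) (\<lambda>_. 0),
      rel_arity = rel_arity L\<rparr>"

definition structure_with_constants ::
    "('f, 'r, 'b) fo_structure \<Rightarrow> ('f + 'b, 'r, 'b) fo_structure" where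
  "structure_with_constants B =
     \<lparr>universe = universe B,
      fun_interp = case_sum (fun_interp B) (\<lambda>b _. b),
      rel_interp = rel_interp B\<rparr>"

text \<open>\<open>weakly_equationally_Noetherian L B\<close> says that \<open>B\<close> is weakly
  $\mathcal{L}(\mathcal{B})$-equationally Noetherian; \<open>L\<close> is the language without the constants.\<close>

definition weakly_equationally_Noetherian ::
    "('f, 'r) fo_language \<Rightarrow> ('f, 'r, 'b) fo_structure \<Rightarrow> bool" where
  "weakly_equationally_Noetherian L B \<longleftrightarrow>
     (\<forall>n. \<forall>S \<subseteq> equations_over (language_with_constants L B) n. infinite S \<longrightarrow>
        (\<exists>S' \<subseteq> equations_over (language_with_constants L B) n. finite S' \<and>
           equivalent_systems (structure_with_constants B) n S S'))"


section \<open>Direct powers\<close>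

definition direct_power ::
    "'i set \<Rightarrow> ('f, 'r, 'a) fo_structure \<Rightarrow> ('f, 'r, 'i \<Rightarrow> 'a) fo_structure" where
  "direct_power I A =
     \<lparr>universe = (\<Pi>\<^sub>E i\<in>I. universe A),
      fun_interp = (\<lambda>f xs. \<lambda>i\<in>I. fun_interp A f (map (\<lambda>x. x i) xs)),
      rel_interp = (\<lambda>r xs. \<forall>i\<in>I. rel_interp A r (map (\<lambda>x. x i) xs))\<rparr>"

lemma is_structure_with_constants:
  "is_structure L B \<Longrightarrow> is_structure (language_with_constants L B) (structure_with_constants B)"
  by (auto simp: is_structure_def language_with_constants_def structure_with_constants_def)

lemma is_structure_direct_power:
  assumes "is_structure L A"
  shows "is_structure L (direct_power I A)"
proof -
  have "map (\<lambda>x. x i) xs \<in> points n (universe A)"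
    if "xs \<in> points n (\<Pi>\<^sub>E i\<in>I. universe A)" "i \<in> I" for xs n i
    using that by (fastforce simp: points_def)
  with assms show ?thesis
    by (auto simp: is_structure_def direct_power_def PiE_eq_empty_iff)
qed

end

theory Submission
  imports Defs
begin

text \<open>
  Over \<open>\<Pi>A\<close> an equation \<open>e\<close> amounts to a family of equations over \<open>A\<close>, one per coordinate, which
  differ only in the values of the constants. Let \<open>instances e\<close> be the set of all subsets of
  \<open>A\<^sup>n\<close> defined by \<open>e\<close> under arbitrary reassignments of its constants in \<open>A\<close>. Any family
  \<open>I \<rightarrow> instances e\<close> is realised by a single equation over \<open>\<Pi>A\<close>: change the constants of \<open>e\<close>
  coordinate by coordinate. Since \<open>A\<close> is finite, \<open>instances\<close> takes finitely many values; pick one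
  equation of \<open>S\<close> for each value \<open>m\<close>. For each \<open>d \<subseteq> A\<^sup>n\<close>, glue from it an equation which in
  coordinate \<open>i\<close> defines \<open>d\<close> if some \<open>e \<in> S\<close> with \<open>instances e = m\<close> does so, and otherwise
  agrees with an arbitrary such \<open>e\<close>. These finitely many equations define, in each coordinate,
  exactly the sets defined by the members of \<open>S\<close>.
\<close>

text \<open>The map \<open>h\<close> is left free so as to cover both the reassignments counted by
  \<open>instances\<close> and, with \<open>h\<close> evaluation at \<open>i\<close>, the
  \<open>i\<close>-th coordinate of the power with its constants.\<close>

definition expand_by ::
    "('f, 'r, 'a) fo_structure \<Rightarrow> ('b \<Rightarrow> 'a) \<Rightarrow> ('f + 'b, 'r, 'a) fo_structure" where
  "expand_by A h =
     \<lparr>universe = universe A,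
      fun_interp = case_sum (fun_interp A) (\<lambda>b _. h b),
      rel_interp = rel_interp A\<rparr>"

definition local_solutions ::
    "('f, 'r, 'a) fo_structure \<Rightarrow> nat \<Rightarrow> ('b \<Rightarrow> 'a) \<Rightarrow> ('f + 'b, 'r) atomic_formula \<Rightarrow> 'a list set"
  where "local_solutions A n h e = solution_set (expand_by A h) n {e}"

definition instances ::
    "('f, 'r, 'a) fo_structure \<Rightarrow> nat \<Rightarrow> 'b set \<Rightarrow> ('f + 'b, 'r) atomic_formula \<Rightarrow> 'a list set set"
  where "instances A n B e = (\<lambda>h. local_solutions A n h e) ` (B \<rightarrow> universe A)"

abbreviation rename_constants ::
    "('b \<Rightarrow> 'c) \<Rightarrow> ('f + 'b, 'r) atomic_formula \<Rightarrow> ('f + 'c, 'r) atomic_formula" where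
  "rename_constants \<sigma> \<equiv> map_atomic_formula (map_sum id \<sigma>) id"

lemma expand_by_simps [simp]:
  "universe (expand_by A h) = universe A"
  "fun_interp (expand_by A h) (Inl f) = fun_interp A f"
  "fun_interp (expand_by A h) (Inr b) xs = h b"
  "rel_interp (expand_by A h) = rel_interp A"
  by (simp_all add: expand_by_def)

lemma structure_with_constants_simps [simp]:
  "universe (structure_with_constants B) = universe B"
  "fun_interp (structure_with_constants B) (Inl f) = fun_interp B f"
  "fun_interp (structure_with_constants B) (Inr b) xs = b"
  "rel_interp (structure_with_constants B) = rel_interp B"
  by (simp_all add: structure_with_constants_def)

lemma finite_points: "finite X \<Longrightarrow> finite (points n X)"
  using finite_lists_length_eq[of X n] by (simp add: points_def conj_commute)

lemma points_map: "xs \<in> points n X \<Longrightarrow> f \<in> X \<rightarrow> Y \<Longrightarrow> map f xs \<in> points n Y"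
  by (auto simp: points_def)

lemma term_value_in_universe:
  assumes "is_structure L A" "p \<in> points n (universe A)" "t \<in> terms_over L n"
  shows "term_value A p t \<in> universe A"
  using assms(3)
proof induction
  case (Var i)
  then show ?case using assms(2) by (auto simp: points_def)
next
  case (App f ts)
  then have "map (term_value A p) ts \<in> points (fun_arity L f) (universe A)"
    by (auto simp: points_def)
  with App.hyps(1) assms(1) show ?case by (simp add: is_structure_def)
qed

text \<open>A substitution principle: rewriting constants in the syntax is traded for rereading them
  in \<open>A\<close>, so a change of reading can be achieved by another term.\<close>

lemma term_value_rename_constants:
  "term_value (expand_by A h) q (map_fo_term (map_sum id \<sigma>) t) =
   term_value (expand_by A (h \<circ> \<sigma>)) q t"
proof (induction t)
  case (App f ts)
  then have "map (term_value (expand_by A h) q \<circ> map_fo_term (map_sum id \<sigma>)) ts =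
      map (term_value (expand_by A (h \<circ> \<sigma>)) q) ts"
    unfolding map_eq_conv o_apply by blast
  then show ?case by (cases f) (simp_all add: o_def id_def del: map_eq_conv)
qed simp

lemma satisfies_rename_constants:
  "satisfies (expand_by A h) q (rename_constants \<sigma> e) \<longleftrightarrow>
   satisfies (expand_by A (h \<circ> \<sigma>)) q e"
proof (cases e)
  case (Relation r ts)
  have "map (term_value (expand_by A h) q \<circ> map_fo_term (map_sum id \<sigma>)) ts =
      map (term_value (expand_by A (h \<circ> \<sigma>)) q) ts"
    by (simp add: term_value_rename_constants)
  with Relation show ?thesis by (simp del: map_eq_conv)
qed (simp add: term_value_rename_constants)

lemma local_solutions_rename_constants:
  "local_solutions A n h (rename_constants \<sigma> e) = local_solutions A n (h \<circ> \<sigma>) e"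
  by (simp add: local_solutions_def solution_set_def satisfies_rename_constants)

lemma terms_over_rename_constants:
  assumes "t \<in> terms_over (language_with_constants L B) n"
    and "\<sigma> \<in> universe B \<rightarrow> universe C"
  shows "map_fo_term (map_sum id \<sigma>) t \<in> terms_over (language_with_constants L C) n"
  using assms(1)
proof induction
  case (Var i)
  then show ?case by (simp add: terms_over.Var)
next
  case (App f ts)
  then show ?case using assms(2)
    by (auto simp: language_with_constants_def intro!: terms_over.App)
qed

lemma equations_over_rename_constants:
  assumes "e \<in> equations_over (language_with_constants L B) n"
    and "\<sigma> \<in> universe B \<rightarrow> universe C"
  shows "rename_constants \<sigma> e \<in> equations_over (language_with_constants L C) n"
proof (cases e)
  case (Equality s t)
  with assms show ?thesis
    by (auto simp: equations_over_def intro: terms_over_rename_constants)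
next
  case (Relation r ts)
  have rel_arity_L: "rel_arity (language_with_constants L B) = rel_arity L"
    by (simp add: language_with_constants_def)
  have "map (map_fo_term (map_sum id \<sigma>)) ts \<in>
      points (rel_arity L r) (terms_over (language_with_constants L C) n)"
    by (rule points_map[where X = "terms_over (language_with_constants L B) n"])
      (use assms Relation in \<open>auto simp: equations_over_def rel_arity_L
        intro: terms_over_rename_constants\<close>)
  with assms(1) Relation show ?thesis
    by (auto simp: equations_over_def language_with_constants_def)
qed

text \<open>Symbols of \<open>L\<close> act coordinate-wise and the constant \<open>b\<close>
  contributes \<open>b i\<close>. The index must lie in \<open>I\<close>, since function values in
  the power are \<open>undefined\<close> elsewhere.\<close>

lemma term_value_direct_power:
  fixes A :: "('f, 'r, 'a) fo_structure" and I :: "'i set"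
  assumes "t \<in> terms_over (language_with_constants L (direct_power I A)) n"
    and "p \<in> points n (universe (direct_power I A))" and "i \<in> I"
  shows "term_value (structure_with_constants (direct_power I A)) p t i =
    term_value (expand_by A (\<lambda>b. b i)) (map (\<lambda>x. x i) p) t"
  using assms(1)
proof induction
  case (Var j)
  then show ?case using assms(2) by (simp add: points_def)
next
  case (App f ts)
  then have "map ((\<lambda>x. x i) \<circ> term_value (structure_with_constants (direct_power I A)) p) ts =
      map (term_value (expand_by A (\<lambda>b. b i)) (map (\<lambda>x. x i) p)) ts"
    by simp
  then show ?case using assms(3)
    by (cases f) (simp_all add: direct_power_def o_def del: map_eq_conv)
qed

lemma satisfies_direct_power:
  fixes A :: "('f, 'r, 'a) fo_structure" and I :: "'i set"
  assumes "is_structure L A"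
    and "e \<in> equations_over (language_with_constants L (direct_power I A)) n"
    and p: "p \<in> points n (universe (direct_power I A))"
  shows "satisfies (structure_with_constants (direct_power I A)) p e \<longleftrightarrow>
    (\<forall>i\<in>I. map (\<lambda>x. x i) p \<in> local_solutions A n (\<lambda>b. b i) e)"
proof -
  let ?B = "structure_with_constants (direct_power I A)"
  let ?L = "language_with_constants L (direct_power I A)"
  \<comment> \<open>Elements of the power are \<open>undefined\<close> off \<open>I\<close>, so once
    the values are known to be such elements, their equality reduces to agreement on
    \<open>I\<close>.\<close>
  have val: "term_value ?B p t \<in> (\<Pi>\<^sub>E i\<in>I. universe A)" if "t \<in> terms_over ?L n" for t
    using term_value_in_universe[OF is_structure_with_constants[OF
        is_structure_direct_power[OF assms(1)]] _ that, of p] p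
    by (simp add: direct_power_def)
  have "satisfies ?B p e \<longleftrightarrow>
      (\<forall>i\<in>I. satisfies (expand_by A (\<lambda>b. b i)) (map (\<lambda>x. x i) p) e)"
  proof (cases e)
    case (Equality s t)
    with assms(2) have "s \<in> terms_over ?L n" "t \<in> terms_over ?L n"
      by (auto simp: equations_over_def)
    moreover from this have "term_value ?B p s = term_value ?B p t \<longleftrightarrow>
        (\<forall>i\<in>I. term_value ?B p s i = term_value ?B p t i)"
      by (metis PiE_ext val)
    ultimately show ?thesis using Equality p by (simp add: term_value_direct_power)
  next
    case (Relation r ts)
    with assms(2) have "set ts \<subseteq> terms_over ?L n"
      by (auto simp: equations_over_def points_def)
    then have "map ((\<lambda>x. x i) \<circ> term_value ?B p) ts =
        map (term_value (expand_by A (\<lambda>b. b i)) (map (\<lambda>x. x i) p)) ts" if "i \<in> I" for i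
      using that p by (auto simp: term_value_direct_power)
    then show ?thesis using Relation
      by (simp add: direct_power_def del: map_eq_conv)
  qed
  moreover have "map (\<lambda>x. x i) p \<in> points n (universe A)" if "i \<in> I" for i
    using p by (rule points_map) (use that in \<open>auto simp: direct_power_def\<close>)
  ultimately show ?thesis
    by (auto simp: local_solutions_def solution_set_def)
qed

text \<open>Thus \<open>S\<close> matters only through the collection of sets that it defines in
  each coordinate; a finite system with the same collections is equivalent to it.\<close>

lemma solution_set_direct_power:
  assumes "is_structure L A"
    and "S \<subseteq> equations_over (language_with_constants L (direct_power I A)) n"
  shows "solution_set (structure_with_constants (direct_power I A)) n S =
    {p \<in> points n (universe (direct_power I A)).
      \<forall>i\<in>I. \<forall>e\<in>S. map (\<lambda>x. x i) p \<in> local_solutions A n (\<lambda>b. b i) e}"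
  using assms(2) satisfies_direct_power[OF assms(1)]
  by (fastforce simp: solution_set_def)

lemma instances_subset: "instances A n B e \<subseteq> Pow (points n (universe A))"
  by (auto simp: instances_def local_solutions_def solution_set_def)

lemma local_solutions_in_instances:
  "i \<in> I \<Longrightarrow> local_solutions A n (\<lambda>b. b i) e \<in> instances A n (universe (direct_power I A)) e"
  by (auto simp: instances_def direct_power_def)

text \<open>An element of the power is an arbitrary family, so the constants of one equation can be
  reassigned independently in each coordinate.\<close>

lemma realise_instances:
  fixes A :: "('f, 'r, 'a) fo_structure" and I :: "'i set"
  assumes e: "e \<in> equations_over (language_with_constants L (direct_power I A)) n"
    and g: "\<And>i. i \<in> I \<Longrightarrow> g i \<in> instances A n (universe (direct_power I A)) e"
  obtains e' where "e' \<in> equations_over (language_with_constants L (direct_power I A)) n"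
    and "\<And>i. i \<in> I \<Longrightarrow> local_solutions A n (\<lambda>b. b i) e' = g i"
proof -
  have "\<forall>i\<in>I. \<exists>h. h \<in> universe (direct_power I A) \<rightarrow> universe A \<and> g i = local_solutions A n h e"
    using g by (fastforce simp: instances_def)
  then obtain h where h: "\<And>i. i \<in> I \<Longrightarrow> h i \<in> universe (direct_power I A) \<rightarrow> universe A"
      "\<And>i. i \<in> I \<Longrightarrow> g i = local_solutions A n (h i) e"
    by metis
  \<comment> \<open>\<sigma> packs the chosen reassignments into the power: its value at
    \<open>b\<close>, evaluated at \<open>i\<close>, is \<open>h i b\<close>.\<close>
  define \<sigma> where "\<sigma> = (\<lambda>b. \<lambda>i\<in>I. h i b)"
  have "\<sigma> \<in> universe (direct_power I A) \<rightarrow> universe (direct_power I A)"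
    using h(1) by (fastforce simp: \<sigma>_def direct_power_def Pi_iff)
  from equations_over_rename_constants[OF e this] show thesis
  proof (rule that)
    show "local_solutions A n (\<lambda>b. b i) (rename_constants \<sigma> e) = g i" if "i \<in> I" for i
    proof -
      have "(\<lambda>b. b i) \<circ> \<sigma> = h i" using that by (auto simp: \<sigma>_def)
      with h(2)[OF that] show ?thesis by (simp add: local_solutions_rename_constants)
    qed
  qed
qed

theorem theorem6p1:
  fixes L :: "('f, 'r) fo_language"
    and A :: "('f, 'r, 'a) fo_structure"
    and I :: "'i set"
  assumes "is_structure L A"
    and "finite (universe A)"
  shows "weakly_equationally_Noetherian L (direct_power I A)"
  unfolding weakly_equationally_Noetherian_def
proof (intro allI impI)
  fix n and S :: "('f + ('i \<Rightarrow> 'a), 'r) atomic_formula set"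
  let ?E = "equations_over (language_with_constants L (direct_power I A)) n"
  let ?inst = "instances A n (universe (direct_power I A))"
  let ?D = "Pow (points n (universe A))"
  let ?loc = "\<lambda>i. local_solutions A n (\<lambda>b. b i)"
  assume S: "S \<subseteq> ?E"
  have fin: "finite ?D" using assms(2) by (simp add: finite_points)
  \<comment> \<open>Each value of \<open>?inst\<close> is a set of subsets of the finite set of
    points over \<open>A\<close>, which bounds their number whatever the size of \<open>S\<close>
    and \<open>I\<close>.\<close>
  have "?inst ` S \<subseteq> Pow ?D" using instances_subset by blast
  then have fin_inst: "finite (?inst ` S)" using fin by (meson finite_Pow_iff finite_subset)
  \<comment> \<open>Membership in the image of \<open>S\<close> keeps out foreign sets; the
    implication makes \<open>d\<close> appear wherever an equation with instances \<open>m\<close>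
    provides it.\<close>
  define glues where "glues m d e' \<longleftrightarrow> e' \<in> ?E \<and>
      (\<forall>i\<in>I. ?loc i e' \<in> ?loc i ` S \<and>
        ((\<exists>e\<in>S. ?inst e = m \<and> ?loc i e = d) \<longrightarrow> ?loc i e' = d))" for m d e'
  have "\<exists>e'. glues m d e'" if m: "m \<in> ?inst ` S" for m d
  proof -
    from m obtain r where r: "r \<in> S" "?inst r = m" by blast
    \<comment> \<open>The default is \<open>r\<close>, used in coordinates where no equation with
      instances \<open>m\<close> defines \<open>d\<close>.\<close>
    then have "\<exists>e\<in>S. ?inst e = m \<and> ((\<exists>e\<in>S. ?inst e = m \<and> ?loc i e = d) \<longrightarrow> ?loc i e = d)" for i
      by metis
    then obtain c where c: "\<And>i. c i \<in> S" "\<And>i. ?inst (c i) = m"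
        "\<And>i. (\<exists>e\<in>S. ?inst e = m \<and> ?loc i e = d) \<longrightarrow> ?loc i (c i) = d"
      by metis
    \<comment> \<open>The equations \<open>c i\<close> vary with \<open>i\<close> but share their
      instances with \<open>r\<close>, so one equation built from \<open>r\<close> imitates them
      all.\<close>
    have "?loc i (c i) \<in> ?inst r" if "i \<in> I" for i
      using local_solutions_in_instances[OF that, of A n "c i"] c(2) r(2) by simp
    with r(1) S obtain e' where "e' \<in> ?E" "\<And>i. i \<in> I \<Longrightarrow> ?loc i e' = ?loc i (c i)"
      using realise_instances[of r L I A n "\<lambda>i. ?loc i (c i)"] by blast
    with c have "glues m d e'" by (auto simp: glues_def)
    then show ?thesis ..
  qed
  then obtain G where G: "glues m d (G m d)" if "m \<in> ?inst ` S" for m d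
    by metis
  define S' where "S' = (\<lambda>(m, d). G m d) ` (?inst ` S \<times> ?D)"
  have S': "S' \<subseteq> ?E" using G by (auto simp: S'_def glues_def)
  have same_local: "?loc i ` S' = ?loc i ` S" if i: "i \<in> I" for i
  proof (intro equalityI subsetI)
    fix X assume "X \<in> ?loc i ` S'"
    then show "X \<in> ?loc i ` S" using G i by (fastforce simp: S'_def glues_def)
  next
    fix X assume "X \<in> ?loc i ` S"
    then obtain e where e: "e \<in> S" "X = ?loc i e" by blast
    have "X \<in> ?D"
      using local_solutions_in_instances[OF i] instances_subset e(2) by blast
    with e(1) have "G (?inst e) X \<in> S'" by (force simp: S'_def)
    \<comment> \<open>Here \<open>e\<close> itself witnesses the premise of the implication in
      \<open>glues\<close>.\<close>
    moreover have "?loc i (G (?inst e) X) = X"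
      using G[of "?inst e" X] e i unfolding glues_def by blast
    ultimately show "X \<in> ?loc i ` S'" by (metis image_eqI)
  qed
  \<comment> \<open>Both sides say that \<open>q\<close> lies in every set of the image, and the two
    images coincide.\<close>
  have "(\<forall>e\<in>S. q \<in> ?loc i e) \<longleftrightarrow> (\<forall>e\<in>S'. q \<in> ?loc i e)" if "i \<in> I" for i q
    using same_local[OF that] by (metis (no_types, lifting) image_iff)
  then have "equivalent_systems (structure_with_constants (direct_power I A)) n S S'"
    unfolding equivalent_systems_def solution_set_direct_power[OF assms(1) S]
      solution_set_direct_power[OF assms(1) S'] by auto
  moreover have "finite S'" using fin fin_inst by (simp add: S'_def)
  ultimately show "\<exists>S'\<subseteq>?E. finite S' \<and>
      equivalent_systems (structure_with_constants (direct_power I A)) n S S'"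
    using S' by blast
qed

end
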